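(* For any positive integers $m$ and $n$, $$N(C_m\times P_n)\le\sum_{k=1}^{n}\left(|\mathcal{C}_{m,k}|-|\mathcal{C}'_{m,k}|\right)\cdot(n-k+1),$$ where equality holds when $m\le 7$.
   Context: A connected set of a graph $H$ is a non-empty vertex set inducing a connected subgraph; $\mathcal{C}(H)$ is the set of connected sets of $H$ and $N(H)=|\mathcal{C}(H)|$. $K_m$ is the complete graph and $C_m$ the cycle on $m$ vertices, $P_n$ the path on $n$ vertices. The vertex set of $K_m\times P_k$ is $\{v_{i,j}:1\le i\le m,\ 1\le j\le k\}$, where $v_{i_1,j}v_{i_2,j}$ is an edge for all $i_1\neq i_2$, and $v_{i,j_1}v_{i,j_2}$ is an edge iff $|j_1-j_2|=1$. $C_m\times P_k$ has the same vertex set, with $v_{i,j}v_{i',j}$ an edge iff $i\ne i'$ and $i'-i\equiv\pm1\pmod m$, and $v_{i,j_1}v_{i,j_2}$ an edge iff $|j_1-j_2|=1$. The $j$-th column is $I_j=\{v_{i,j}:1\le i\le m\}$. $\mathcal{C}_{m,k}$ is the set of $C\in\mathcal{C}(K_m\times P_k)$ containing at least one vertex of every column, and $\mathcal{C}'_{m,k}$ is the set of $C\in\mathcal{C}(K_m\times P_k)\setminus\mathcal{C}(C_m\times P_k)$ containing at least one vertex of every column. *)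

theory Defs
  imports
    Complex_Main
    "HOL-Number_Theory.Cong"
    "Graph_Theory.Graph_Theory"
begin

text \<open>
  Finite simple graphs are the \<open>pair_graph\<close>s of the \<open>Graph_Theory\<close> library: an undirected
  edge is represented by its two arcs.
\<close>

definition connected_sets :: "'a pair_pre_digraph \<Rightarrow> 'a set set" where
  "connected_sets H =
     {S. S \<subseteq> pverts H \<and> S \<noteq> {} \<and> Digraph_Component.connected (with_proj H \<restriction> S)}"

definition num_connected_sets :: "'a pair_pre_digraph \<Rightarrow> nat" where
  "num_connected_sets H = card (connected_sets H)"

text \<open>The vertex \<open>v\<^bsub>i,j\<^esub>\<close> is the pair \<open>(i, j)\<close>: the second component is the column index.\<close>

definition grid_verts :: "nat \<Rightarrow> nat \<Rightarrow> (nat \<times> nat) set" where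
  "grid_verts m k = {1..m} \<times> {1..k}"

definition complete_times_path :: "nat \<Rightarrow> nat \<Rightarrow> (nat \<times> nat) pair_pre_digraph" where
  "complete_times_path m k =
     \<lparr> pverts = grid_verts m k,
       parcs = {((i1, j1), (i2, j2)).
         (i1, j1) \<in> grid_verts m k \<and> (i2, j2) \<in> grid_verts m k \<and>
         (j1 = j2 \<and> i1 \<noteq> i2 \<or> i1 = i2 \<and> \<bar>int j1 - int j2\<bar> = 1)} \<rparr>"

text \<open>
  The condition \<open>i1 \<noteq> i2\<close> matters only for \<open>m = 1\<close>, where every congruence holds:
  the cycles on one and two vertices are a single vertex and a single edge.
\<close>

definition cycle_times_path :: "nat \<Rightarrow> nat \<Rightarrow> (nat \<times> nat) pair_pre_digraph" where
  "cycle_times_path m k =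
     \<lparr> pverts = grid_verts m k,
       parcs = {((i1, j1), (i2, j2)).
         (i1, j1) \<in> grid_verts m k \<and> (i2, j2) \<in> grid_verts m k \<and>
         (j1 = j2 \<and> i1 \<noteq> i2 \<and>
            ([int i2 - int i1 = 1] (mod int m) \<or> [int i2 - int i1 = - 1] (mod int m)) \<or>
          i1 = i2 \<and> \<bar>int j1 - int j2\<bar> = 1)} \<rparr>"

definition column :: "nat \<Rightarrow> nat \<Rightarrow> (nat \<times> nat) set" where
  "column m j = {(i, j) | i. i \<in> {1..m}}"

definition full_sets :: "nat \<Rightarrow> nat \<Rightarrow> (nat \<times> nat) set set" where
  "full_sets m k =
     {C \<in> connected_sets (complete_times_path m k). \<forall>j\<in>{1..k}. C \<inter> column m j \<noteq> {}}"

definition full_sets' :: "nat \<Rightarrow> nat \<Rightarrow> (nat \<times> nat) set set" where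
  "full_sets' m k =
     {C \<in> connected_sets (complete_times_path m k) - connected_sets (cycle_times_path m k).
        \<forall>j\<in>{1..k}. C \<inter> column m j \<noteq> {}}"

lemma finite_connected_sets:
  assumes "finite (pverts H)"
  shows "finite (connected_sets H)"
  by (rule finite_subset[of _ "Pow (pverts H)"]) (auto simp: connected_sets_def assms)

lemma finite_grid_arcs: "finite {p. fst p \<in> grid_verts m k \<and> snd p \<in> grid_verts m k \<and> Q p}"
  by (rule finite_subset[of _ "grid_verts m k \<times> grid_verts m k"]) (auto simp: grid_verts_def)

lemma pair_graph_complete_times_path: "pair_graph (complete_times_path m k)"
proof
  show "finite (parcs (complete_times_path m k))"
    by (rule finite_subset[OF _ finite_grid_arcs[of m k "\<lambda>_. True"]])
       (auto simp: complete_times_path_def)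
  show "symmetric (with_proj (complete_times_path m k))"
    by (auto simp: symmetric_def sym_def complete_times_path_def)
qed (auto simp: complete_times_path_def grid_verts_def)

lemma pair_graph_cycle_times_path: "pair_graph (cycle_times_path m k)"
proof
  show "finite (parcs (cycle_times_path m k))"
    by (rule finite_subset[OF _ finite_grid_arcs[of m k "\<lambda>_. True"]])
       (auto simp: cycle_times_path_def)
  have cong_swap: "[a - b = c] (mod d) \<Longrightarrow> [b - a = - c] (mod d)" for a b c d :: int
    by (metis cong_minus_minus_iff minus_diff_eq)
  show "symmetric (with_proj (cycle_times_path m k))"
    by (auto simp: symmetric_def sym_def cycle_times_path_def dest: cong_swap)
qed (auto simp: cycle_times_path_def grid_verts_def)

end

theory Submission
  imports Defs
begin

text \<open>
  Since \<open>C\<^sub>m\<close> is a subgraph of \<open>K\<^sub>m\<close>, the difference \<open>\<bar>\<C>\<^sub>m\<^sub>,\<^sub>k\<bar> - \<bar>\<C>'\<^sub>m\<^sub>,\<^sub>k\<bar>\<close> counts the connected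
  sets of \<open>C\<^sub>m \<times> P\<^sub>k\<close> that meet every column. The columns met by a connected set of
  \<open>C\<^sub>m \<times> P\<^sub>n\<close> form an interval, and an interval of length \<open>k\<close> has \<open>n - k + 1\<close> positions in
  \<open>{1..n}\<close>.
\<close>

text \<open>The library defines connectedness as strong connectedness of the symmetric closure of
  the induced subgraph. In a pair graph every arc already has its reverse, so the closure adds
  nothing, and \<open>rtrancl_on S\<close> only walks through vertices of \<open>S\<close>, so it
  does not see the arcs that the restriction removes. This form opens the way to induction along
  walks.\<close>

lemma connected_sets_pair_graph:
  assumes "pair_graph H"
  shows "connected_sets H =
    {S. S \<subseteq> pverts H \<and> S \<noteq> {} \<and> (\<forall>u\<in>S. \<forall>v\<in>S. (u, v) \<in> rtrancl_on S (parcs H))}"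
proof -
  interpret pair_graph H by fact
  have sym: "(v, u) \<in> parcs H" if "(u, v) \<in> parcs H" for u v
    using that by (rule arcs_symmetric)
  have "Digraph_Component.connected (with_proj H \<restriction> S) \<longleftrightarrow>
      S \<noteq> {} \<and> (\<forall>u\<in>S. \<forall>v\<in>S. (u, v) \<in> rtrancl_on S (parcs H))" for S
  proof -
    define R where "R = {(u, v) \<in> parcs H. u \<in> S \<and> v \<in> S}"
    have "parcs (mk_symmetric (with_proj H \<restriction> S)) = R"
      by (auto simp: mk_symmetric_def induce_subgraph_def R_def sym)
    moreover have "pverts (mk_symmetric (with_proj H \<restriction> S)) = S"
      by (simp add: mk_symmetric_def induce_subgraph_def)
    moreover have "(u, v) \<in> rtrancl_on S R \<longleftrightarrow> (u, v) \<in> rtrancl_on S (parcs H)" for u v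
    proof
      show "(u, v) \<in> rtrancl_on S (parcs H)" if "(u, v) \<in> rtrancl_on S R"
        using that by (rule rtrancl_on_mono[rotated 2]) (auto simp: R_def)
      show "(u, v) \<in> rtrancl_on S R" if "(u, v) \<in> rtrancl_on S (parcs H)"
        using that
        by (induct rule: rtrancl_on_induct) (auto simp: R_def intro: rtrancl_on_into_rtrancl_on)
    qed
    ultimately show ?thesis
      by (simp add: Digraph_Component.connected_def strongly_connected_def reachable_def)
  qed
  then show ?thesis
    by (auto simp: connected_sets_def)
qed

lemma connected_sets_image:
  assumes "pair_graph G" "pair_graph H"
    and S: "S \<in> connected_sets G"
    and verts: "f ` S \<subseteq> pverts H"
    and arcs: "\<And>u v. u \<in> S \<Longrightarrow> v \<in> S \<Longrightarrow> (u, v) \<in> parcs G \<Longrightarrow> (f u, f v) \<in> parcs H"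
  shows "f ` S \<in> connected_sets H"
proof -
  have "(f u, f v) \<in> rtrancl_on (f ` S) (parcs H)" if "(u, v) \<in> rtrancl_on S (parcs G)" for u v
    using that
    by (induct rule: rtrancl_on_induct) (auto intro: rtrancl_on_into_rtrancl_on arcs)
  then show ?thesis
    using S verts
    by (auto simp: connected_sets_pair_graph[OF assms(1)] connected_sets_pair_graph[OF assms(2)])
qed

lemma connected_sets_cycle_subset_complete:
  "connected_sets (cycle_times_path m k) \<subseteq> connected_sets (complete_times_path m k)"
proof
  fix S assume S: "S \<in> connected_sets (cycle_times_path m k)"
  have "id ` S \<in> connected_sets (complete_times_path m k)"
    using pair_graph_cycle_times_path pair_graph_complete_times_path S
  proof (rule connected_sets_image)
    show "id ` S \<subseteq> pverts (complete_times_path m k)"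
      using S by (simp add: connected_sets_def cycle_times_path_def complete_times_path_def)
  qed (auto simp: cycle_times_path_def complete_times_path_def)
  then show "S \<in> connected_sets (complete_times_path m k)"
    by simp
qed

definition full_cycle_sets :: "nat \<Rightarrow> nat \<Rightarrow> (nat \<times> nat) set set" where
  "full_cycle_sets m k =
     {C \<in> connected_sets (cycle_times_path m k). \<forall>j\<in>{1..k}. C \<inter> column m j \<noteq> {}}"

lemma finite_connected_sets_complete: "finite (connected_sets (complete_times_path m k))"
  by (rule finite_connected_sets) (simp add: complete_times_path_def grid_verts_def)

lemma finite_full_cycle_sets: "finite (full_cycle_sets m k)"
  using connected_sets_cycle_subset_complete[of m k]
  by (intro finite_subset[OF _ finite_connected_sets_complete[of m k]])
    (auto simp: full_cycle_sets_def)

text \<open>\<open>full_sets m k\<close> is the disjoint union of \<open>full_sets' m k\<close> and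
  \<open>full_cycle_sets m k\<close>, because a set connected in the cycle grid stays connected in
  the complete grid.\<close>

lemma card_full_sets_diff:
  "int (card (full_sets m k)) - int (card (full_sets' m k)) = int (card (full_cycle_sets m k))"
proof -
  have "full_sets m k = full_sets' m k \<union> full_cycle_sets m k"
    using connected_sets_cycle_subset_complete[of m k]
    by (auto simp: full_sets_def full_sets'_def full_cycle_sets_def)
  moreover have "full_sets' m k \<inter> full_cycle_sets m k = {}"
    by (auto simp: full_sets'_def full_cycle_sets_def)
  moreover have "finite (full_sets' m k)"
    by (rule finite_subset[OF _ finite_connected_sets_complete[of m k]])
      (auto simp: full_sets'_def)
  ultimately show ?thesis
    using finite_full_cycle_sets by (simp add: card_Un_disjoint)
qed

text \<open>A discrete intermediate value argument: an arc changes the column by at most one, so a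
  walk inside \<open>S\<close> from \<open>u\<close> to \<open>v\<close> cannot jump over column
  \<open>j\<close>.\<close>

lemma connected_set_meets_between:
  assumes S: "S \<in> connected_sets (cycle_times_path m n)"
    and "u \<in> S" "v \<in> S" "snd u \<le> j" "j \<le> snd v"
  shows "j \<in> snd ` S"
proof -
  have "(u, v) \<in> rtrancl_on S (parcs (cycle_times_path m n))"
    using assms connected_sets_pair_graph[OF pair_graph_cycle_times_path] by auto
  then have "j \<le> snd v \<longrightarrow> j \<in> snd ` S"
  proof (induct rule: rtrancl_on_induct)
    case base
    then show ?case using assms(4) by (auto intro!: image_eqI[of _ _ u])
  next
    case (step y z)
    have "snd z \<le> snd y + 1"
      using step(2) by (auto simp: cycle_times_path_def)
    \<comment> \<open>Either the walk had reached column \<open>j\<close> by \<open>y\<close>, and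
      the induction hypothesis applies, or it was still to the left, and then \<open>z\<close> can
      at best land exactly on column \<open>j\<close>.\<close>
    then consider "j \<le> snd y" | "j \<le> snd z \<longrightarrow> j = snd z"
      by linarith
    then show ?case using step(4,5) by cases auto
  qed
  with assms(5) show ?thesis by simp
qed

lemma snd_image_full_cycle_set:
  assumes "C \<in> full_cycle_sets m k"
  shows "snd ` C = {1..k}"
proof
  show "snd ` C \<subseteq> {1..k}"
    using assms
    by (force simp: full_cycle_sets_def connected_sets_def cycle_times_path_def grid_verts_def)
  show "{1..k} \<subseteq> snd ` C"
    using assms by (force simp: full_cycle_sets_def column_def)
qed

lemma full_cycle_setsI:
  assumes "C \<in> connected_sets (cycle_times_path m k)" "{1..k} \<subseteq> snd ` C"
  shows "C \<in> full_cycle_sets m k"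
proof -
  have "C \<subseteq> grid_verts m k"
    using assms(1) by (simp add: connected_sets_def cycle_times_path_def)
  have "C \<inter> column m j \<noteq> {}" if j: "j \<in> {1..k}" for j
  proof -
    obtain i where "(i, j) \<in> C"
      using assms(2) j by auto
    moreover from this have "(i, j) \<in> column m j"
      using \<open>C \<subseteq> grid_verts m k\<close> by (auto simp: grid_verts_def column_def)
    ultimately show ?thesis by blast
  qed
  then show ?thesis using assms(1) by (simp add: full_cycle_sets_def)
qed

definition shift_up :: "nat \<Rightarrow> nat \<times> nat \<Rightarrow> nat \<times> nat" where
  "shift_up a = (\<lambda>(i, j). (i, j + a))"

text \<open>Subtraction on naturals truncates at 0, so \<open>shift_up a\<close> undoes this map
  only on columns with index at least \<open>a\<close>.\<close>

definition shift_down :: "nat \<Rightarrow> nat \<times> nat \<Rightarrow> nat \<times> nat" where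
  "shift_down a = (\<lambda>(i, j). (i, j - a))"

lemma shift_up_connected:
  assumes "C \<in> connected_sets (cycle_times_path m k)" "a + k \<le> n"
  shows "shift_up a ` C \<in> connected_sets (cycle_times_path m n)"
  using pair_graph_cycle_times_path pair_graph_cycle_times_path assms(1)
proof (rule connected_sets_image)
  show "shift_up a ` C \<subseteq> pverts (cycle_times_path m n)"
    using assms
    by (force simp: connected_sets_def cycle_times_path_def grid_verts_def shift_up_def)
qed (use assms(2) in \<open>auto simp: cycle_times_path_def grid_verts_def shift_up_def\<close>)

text \<open>The bound on the columns keeps every index of \<open>S\<close> above \<open>a\<close>.
  Hence no subtraction truncates, column differences survive, and the image lies in columns 1 to
  \<open>k\<close>.\<close>

lemma shift_down_connected:
  assumes "S \<in> connected_sets (cycle_times_path m n)" and cols: "snd ` S \<subseteq> {a + 1..a + k}"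
  shows "shift_down a ` S \<in> connected_sets (cycle_times_path m k)"
  using pair_graph_cycle_times_path pair_graph_cycle_times_path assms(1)
proof (rule connected_sets_image)
  have range: "a + 1 \<le> j \<and> j \<le> a + k" if "(i, j) \<in> S" for i j
    using cols that by force
  show "shift_down a ` S \<subseteq> pverts (cycle_times_path m k)"
    using assms(1) range
    by (fastforce simp: connected_sets_def cycle_times_path_def grid_verts_def shift_down_def)
  show "(shift_down a u, shift_down a v) \<in> parcs (cycle_times_path m k)"
    if "u \<in> S" "v \<in> S" "(u, v) \<in> parcs (cycle_times_path m n)" for u v
    using that range[of "fst u" "snd u"] range[of "fst v" "snd v"]
    by (auto simp: cycle_times_path_def grid_verts_def shift_down_def)
qed

text \<open>Here \<open>a\<close> counts the empty columns to the left of \<open>S\<close> and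
  \<open>k\<close> is the number of columns that \<open>S\<close> meets. There are no gaps by
  \<open>connected_set_meets_between\<close>.\<close>

lemma connected_set_columns:
  assumes S: "S \<in> connected_sets (cycle_times_path m n)"
  defines "a \<equiv> Min (snd ` S) - 1" and "k \<equiv> Max (snd ` S) + 1 - Min (snd ` S)"
  shows "snd ` S = {a + 1..a + k}" "1 \<le> k" "a + k \<le> n"
proof -
  have "S \<subseteq> {1..m} \<times> {1..n}" and ne: "S \<noteq> {}"
    using S by (auto simp: connected_sets_def cycle_times_path_def grid_verts_def)
  then have cols: "snd ` S \<subseteq> {1..n}"
    by auto
  then have fin: "finite (snd ` S)"
    by (rule finite_subset) simp
  have min: "Min (snd ` S) \<in> snd ` S" and max: "Max (snd ` S) \<in> snd ` S"
    using fin ne by auto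
  have le: "Min (snd ` S) \<le> Max (snd ` S)"
    using fin max by simp
  \<comment> \<open>Columns are numbered from 1, so the subtraction in \<open>a\<close> is exact and
    \<open>a + 1\<close> is the leftmost column of \<open>S\<close>.\<close>
  have pos: "1 \<le> Min (snd ` S)" and top: "Max (snd ` S) \<le> n"
    using min max cols by auto
  have "snd ` S = {Min (snd ` S)..Max (snd ` S)}"
  proof
    show "snd ` S \<subseteq> {Min (snd ` S)..Max (snd ` S)}"
      using fin by (intro subsetI) (simp only: atLeastAtMost_iff Min_le Max_ge)
    obtain u v where uv: "u \<in> S" "v \<in> S" "Min (snd ` S) = snd u" "Max (snd ` S) = snd v"
      using min max by blast
    show "{Min (snd ` S)..Max (snd ` S)} \<subseteq> snd ` S"
      by (intro subsetI connected_set_meets_between[OF S uv(1,2)]) (simp_all flip: uv(3,4))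
  qed
  then show "snd ` S = {a + 1..a + k}"
    using pos le by (simp add: a_def k_def)
  show "1 \<le> k" "a + k \<le> n"
    using pos le top by (simp_all add: a_def k_def)
qed

text \<open>A connected set is determined by its width \<open>k\<close>, its shape \<open>C\<close>
  moved to the first \<open>k\<close> columns, and its offset \<open>a\<close>. Offsets start at 0,
  so \<open>{..n - k}\<close> has \<open>n - k + 1\<close> elements. The inverse \<open>?g\<close>
  reads width and offset from the extreme columns.\<close>

lemma num_connected_sets_cycle_times_path:
  "num_connected_sets (cycle_times_path m n) =
     (\<Sum>k = 1..n. card (full_cycle_sets m k) * (n - k + 1))"
proof -
  let ?A = "SIGMA k:{1..n}. full_cycle_sets m k \<times> {..n - k}"
  let ?f = "\<lambda>(k :: nat, C, a). shift_up a ` C"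
  let ?g = "\<lambda>S. (Max (snd ` S) + 1 - Min (snd ` S),
    shift_down (Min (snd ` S) - 1) ` S, Min (snd ` S) - 1)"
  have "bij_betw ?f ?A (connected_sets (cycle_times_path m n))"
  proof (rule bij_betw_byWitness[where f' = ?g])
    have "?g (shift_up a ` C) = (k, C, a)" if "k \<in> {1..n}" "C \<in> full_cycle_sets m k" for k C a
    proof -
      have "snd ` shift_up a ` C = (\<lambda>j. j + a) ` (snd ` C)"
        by (simp add: image_image shift_up_def case_prod_beta)
      also have "\<dots> = {1 + a..k + a}"
        using snd_image_full_cycle_set[OF that(2)] by simp
      finally have "snd ` shift_up a ` C = {1 + a..k + a}" .
      \<comment> \<open>As \<open>k\<close> is at least 1, the interval is nonempty and its ends are
        its minimum and maximum.\<close>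
      moreover have "Min {1 + a..k + a} = 1 + a" "Max {1 + a..k + a} = k + a"
        using that(1) by (auto intro: Min_eqI Max_eqI)
      moreover have "shift_down a ` shift_up a ` C = C"
        by (simp add: image_image shift_up_def shift_down_def case_prod_beta)
      ultimately show ?thesis by simp
    qed
    then show "\<forall>x\<in>?A. ?g (?f x) = x"
      by (simp only: Ball_def split_paired_All mem_Sigma_iff prod.case) blast
    show "\<forall>S\<in>connected_sets (cycle_times_path m n). ?f (?g S) = S"
    proof
      fix S assume S: "S \<in> connected_sets (cycle_times_path m n)"
      define a where "a = Min (snd ` S) - 1"
      \<comment> \<open>All columns of \<open>S\<close> lie strictly to the right of
        \<open>a\<close>, so the downward shift loses nothing.\<close>
      have "shift_up a (shift_down a u) = u" if "u \<in> S" for u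
      proof -
        have "snd u \<in> {a + 1..a + (Max (snd ` S) + 1 - Min (snd ` S))}"
          using connected_set_columns(1)[OF S, folded a_def] that by blast
        then show ?thesis by (simp add: shift_up_def shift_down_def case_prod_beta)
      qed
      then have "shift_up a ` shift_down a ` S = S" by (simp add: image_image)
      then show "?f (?g S) = S" by (simp add: a_def)
    qed
    show "?f ` ?A \<subseteq> connected_sets (cycle_times_path m n)"
      by (auto simp: full_cycle_sets_def intro!: shift_up_connected)
    have "?g S \<in> ?A" if "S \<in> connected_sets (cycle_times_path m n)" for S
    proof -
      define a where "a = Min (snd ` S) - 1"
      define k where "k = Max (snd ` S) + 1 - Min (snd ` S)"
      note cols = connected_set_columns[OF that, folded a_def k_def]
      have "snd ` shift_down a ` S = (\<lambda>j. j - a) ` (snd ` S)"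
        by (simp add: image_image shift_down_def case_prod_beta)
      also have "\<dots> \<supseteq> {1..k}"
      proof
        fix j assume "j \<in> {1..k}"
        then show "j \<in> (\<lambda>j. j - a) ` (snd ` S)"
          unfolding cols(1) by (intro image_eqI[of _ _ "j + a"]) auto
      qed
      finally have "shift_down a ` S \<in> full_cycle_sets m k"
        by (intro full_cycle_setsI shift_down_connected[OF that]) (simp add: cols(1))
      then have "(k, shift_down a ` S, a) \<in> ?A"
        using cols(2,3) by auto
      then show ?thesis by (simp add: a_def k_def)
    qed
    then show "?g ` connected_sets (cycle_times_path m n) \<subseteq> ?A" by blast
  qed
  then have "num_connected_sets (cycle_times_path m n) = card ?A"
    by (simp add: num_connected_sets_def bij_betw_same_card)
  also have "\<dots> = (\<Sum>k = 1..n. card (full_cycle_sets m k) * (n - k + 1))"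
    using finite_full_cycle_sets by (simp add: card_SigmaI card_cartesian_product)
  finally show ?thesis .
qed

theorem theorem2p4:
  fixes m n :: nat
  assumes "m \<ge> 1" and "n \<ge> 1"
  shows "int (num_connected_sets (cycle_times_path m n))
           \<le> (\<Sum>k = 1..n. (int (card (full_sets m k)) - int (card (full_sets' m k)))
                            * (int n - int k + 1))
       \<and> (m \<le> 7 \<longrightarrow>
          int (num_connected_sets (cycle_times_path m n))
           = (\<Sum>k = 1..n. (int (card (full_sets m k)) - int (card (full_sets' m k)))
                            * (int n - int k + 1)))"
proof -
  have "int (num_connected_sets (cycle_times_path m n)) =
      (\<Sum>k = 1..n. int (card (full_cycle_sets m k)) * (int n - int k + 1))"
    \<comment> \<open>In the range of summation \<open>k\<close> is at most \<open>n\<close>, so the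
      natural number \<open>n - k\<close> equals the integer difference.\<close>
    unfolding num_connected_sets_cycle_times_path of_nat_sum
    by (intro sum.cong) (auto simp: of_nat_diff distrib_left)
  then show ?thesis
    by (simp add: card_full_sets_diff)
qed

end
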